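(* Let $F=K_{2k}$ with $k\ge 1$, and let $E_k\subseteq E(F)$ be a set of $k$ edges such that the subgraph $\mathscr E_k$ induced by $E_k$ is a perfect matching of $F$. Let $H_{uv}$ be a simple graph of order $m\ge3$ with a specified edge $uv$ such that $u$ and $v$ both have degree $m-1$ in $H_{uv}$, and suppose $H_2=H_{uv}-\{u,v\}$ is $r_2$-regular with $r_2\ge2$. Let $G=G[F,E_k,H_{uv}]$, and let $\zeta,\eta$ be the two roots of $(x-2r_2-2)(x-m)-2(m-2)=0$. Then the spectrum of the signless Laplacian matrix $Q(G)$ is given by: (i) $q$ with multiplicity $k$, for each $q\in\sigma(Q(H_{uv}))\setminus\{m-2,\zeta,\eta\}$; (ii) $m+2k-4$ with multiplicity $k$; (iii) the two roots of the equation $(x-m-4k+4)(x-2r_2-2)-2(m-2)=0$, each with multiplicity $1$; (iv) the two roots of the equation $(x-m-2k+4)(x-2r_2-2)-2(m-2)=0$, each with multiplicity $k-1$.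
   Context: All graphs are finite and simple. $Q(X)=D(X)+A(X)$ is the signless Laplacian matrix of a graph $X$ ($D$ the diagonal degree matrix, $A$ the adjacency matrix), and $\sigma(\cdot)$ is the spectrum as a multiset with multiplicity; differences are multiset differences, and the spectrum described by the list is the multiset union of the listed items. For a graph $X$ of order $s$, $q_1(X)\le\cdots\le q_s(X)$ are the eigenvalues of $Q(X)$. Under the stated hypotheses, $\sigma(Q(H_{uv}))=\{q_j(H_2)+2:1\le j\le m-3\}\cup\{m-2,\zeta,\eta\}$ as multisets. $K_{2k}$ is the complete graph on $2k$ vertices. Graph with $k$ edge-pockets: $H_{uv}$ is a graph with a specified edge $uv$ such that $H_{uv}-u\cong H_{uv}-v$ (automatic when $u,v$ both have degree $m-1$). For $E_k=\{e_1,\ldots,e_k\}\subseteq E(F)$, $G[F,E_k,H_{uv}]$ is obtained by taking one copy of $F$ and $k$ vertex-disjoint copies of $H_{uv}$, and, for each $i=1,\ldots,k$, pasting (identifying) the edge $uv$ of the $i$th copy of $H_{uv}$ with the edge $e_i$ of $F$. *)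

theory Defs
  imports "HOL-Library.Multiset" "HOL-Computational_Algebra.Polynomial"
    "Jordan_Normal_Form.Char_Poly"
begin

section \<open>Finite simple graphs\<close>

text \<open>Edges are two-element vertex sets.\<close>

record 'a graph =
  verts :: "'a set"
  edges :: "'a set set"

definition simple_graph :: "'a graph \<Rightarrow> bool" where
  "simple_graph X \<longleftrightarrow> finite (verts X) \<and> (\<forall>e\<in>edges X. e \<subseteq> verts X \<and> card e = 2)"

definition degree_of :: "'a graph \<Rightarrow> 'a \<Rightarrow> nat" where
  "degree_of X x = card {e \<in> edges X. x \<in> e}"

definition regular_graph :: "nat \<Rightarrow> 'a graph \<Rightarrow> bool" where
  "regular_graph r X \<longleftrightarrow> (\<forall>x\<in>verts X. degree_of X x = r)"

definition complete_graph :: "nat \<Rightarrow> 'a graph \<Rightarrow> bool" where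
  "complete_graph n X \<longleftrightarrow> finite (verts X) \<and> card (verts X) = n \<and>
     edges X = {e. e \<subseteq> verts X \<and> card e = 2}"

definition delete_verts :: "'a graph \<Rightarrow> 'a set \<Rightarrow> 'a graph" where
  "delete_verts X S = \<lparr>verts = verts X - S, edges = {e \<in> edges X. e \<inter> S = {}}\<rparr>"

definition edge_induced :: "'a set set \<Rightarrow> 'a graph" where
  "edge_induced E = \<lparr>verts = \<Union>E, edges = E\<rparr>"

definition perfect_matching :: "'a graph \<Rightarrow> 'a graph \<Rightarrow> bool" where
  "perfect_matching F M \<longleftrightarrow>
     verts M = verts F \<and> edges M \<subseteq> edges F \<and> regular_graph 1 M"

section \<open>Graphs with edge-pockets\<close>

text \<open>
  The copies of \<open>H\<close> are indexed by the edges in the set \<open>E\<close>. Pasting \<open>uv\<close> onto an edge \<open>e\<close> of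
  \<open>F\<close> requires a choice of orientation of \<open>e\<close>, given by \<open>s\<close> and \<open>t\<close> with \<open>e = {s e, t e}\<close>:
  \<open>u\<close> is identified with \<open>s e\<close> and \<open>v\<close> with \<open>t e\<close>. The vertices of the resulting graph are the
  vertices \<open>Inl x\<close> of \<open>F\<close> and, for every \<open>e\<close> in \<open>E\<close> and every vertex \<open>w\<close> of \<open>H\<close> other than
  \<open>u\<close> and \<open>v\<close>, a vertex \<open>Inr (e, w)\<close>.
\<close>

definition pocket_map ::
  "('a set \<Rightarrow> 'a) \<Rightarrow> ('a set \<Rightarrow> 'a) \<Rightarrow> 'b \<Rightarrow> 'b \<Rightarrow> 'a set \<Rightarrow> 'b \<Rightarrow> 'a + 'a set \<times> 'b" where
  "pocket_map s t u v e w =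
     (if w = u then Inl (s e) else if w = v then Inl (t e) else Inr (e, w))"

definition edge_pocket_graph ::
  "'a graph \<Rightarrow> 'a set set \<Rightarrow> ('a set \<Rightarrow> 'a) \<Rightarrow> ('a set \<Rightarrow> 'a) \<Rightarrow>
   'b graph \<Rightarrow> 'b \<Rightarrow> 'b \<Rightarrow> ('a + 'a set \<times> 'b) graph" where
  "edge_pocket_graph F E s t H u v =
     \<lparr>verts = Inl ` verts F \<union> (\<Union>e\<in>E. pocket_map s t u v e ` verts H),
      edges = (\<lambda>d. Inl ` d) ` edges F \<union>
        (\<Union>e\<in>E. (\<lambda>d. pocket_map s t u v e ` d) ` edges H)\<rparr>"

section \<open>Signless Laplacian spectrum\<close>

text \<open>A list \<open>xs\<close> enumerating the vertices fixes the order of rows and columns.\<close>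

definition vertex_order :: "'a graph \<Rightarrow> 'a list \<Rightarrow> bool" where
  "vertex_order X xs \<longleftrightarrow> distinct xs \<and> set xs = verts X"

definition degree_matrix :: "'a list \<Rightarrow> 'a graph \<Rightarrow> real mat" where
  "degree_matrix xs X = mat (length xs) (length xs)
     (\<lambda>(i, j). if i = j then real (degree_of X (xs ! i)) else 0)"

definition adjacency_matrix :: "'a list \<Rightarrow> 'a graph \<Rightarrow> real mat" where
  "adjacency_matrix xs X = mat (length xs) (length xs)
     (\<lambda>(i, j). if {xs ! i, xs ! j} \<in> edges X then 1 else 0)"

definition signless_laplacian :: "'a list \<Rightarrow> 'a graph \<Rightarrow> real mat" where
  "signless_laplacian xs X = degree_matrix xs X + adjacency_matrix xs X"

text \<open>All complex eigenvalues, with algebraic multiplicity.\<close>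

definition mat_spectrum :: "real mat \<Rightarrow> complex multiset" where
  "mat_spectrum A = proots (char_poly (map_mat complex_of_real A))"

text \<open>The two roots, with multiplicity, of \<open>(x - a) * (x - b) - c = 0\<close>.\<close>

definition quadratic_roots :: "complex \<Rightarrow> complex \<Rightarrow> complex \<Rightarrow> complex multiset" where
  "quadratic_roots a b c = proots ([:- a, 1:] * [:- b, 1:] - [:c:])"

end

theory Submission
  imports Defs
begin

text \<open>
  Each pocket meets the base \<open>F\<close> only in the two ends of a matching edge, and both ends see every
  vertex of the pocket. Let \<open>c = x - 2 * r - 2\<close> be the common row sum of the pocket block of
  \<open>x * I - Q(G)\<close>. For \<open>c \<noteq> 0\<close>, adding \<open>1 / c\<close> times the columns of each pocket to the columns of
  its two ends clears the lower left block, so the determinant is \<open>det S\<close> times the \<open>k\<close>-th power of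
  the determinant of one pocket block, where \<open>S\<close> lives on \<open>F\<close>. Ordered by first and second ends of
  the matching edges, \<open>S\<close> has the shape \<open>[[X, Y], [Y, X]]\<close>, and \<open>det S = det (X + Y) * det (X - Y)\<close>
  with \<open>X - Y\<close> scalar and \<open>X + Y\<close> of the form \<open>b * I - 2 * J\<close>. The graph \<open>H\<close> itself is the case
  \<open>k = 1\<close>. Since the pocket polynomial is divisible by \<open>c\<close>, all denominators cancel, and comparing
  the factorisations of the two characteristic polynomials gives the spectrum.
\<close>

section \<open>Determinants indexed by lists\<close>

text \<open>Rows and columns are labelled by list entries instead of positions, so that vertex sets
  can be reordered, split and relabelled as lists.\<close>

definition det_on :: "'a list \<Rightarrow> ('a \<Rightarrow> 'a \<Rightarrow> 'c :: idom) \<Rightarrow> 'c" where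
  "det_on xs f = det (mat (length xs) (length xs) (\<lambda>(i, j). f (xs ! i) (xs ! j)))"

lemma det_on_cong:
  assumes "\<And>x y. x \<in> set xs \<Longrightarrow> y \<in> set xs \<Longrightarrow> f x y = g x y"
  shows "det_on xs f = det_on xs g"
  unfolding det_on_def using assms by (intro arg_cong[where f = det] eq_matI) auto

lemma det_on_map: "det_on (map h xs) f = det_on xs (\<lambda>x y. f (h x) (h y))"
  unfolding det_on_def by (intro arg_cong[where f = det] eq_matI) auto

text \<open>Another enumeration applies one permutation to both rows and columns, so its sign occurs
  twice and cancels.\<close>

lemma det_on_mset_eq:
  assumes "mset xs = mset ys"
  shows "det_on xs f = det_on ys f"
proof -
  obtain p where p: "p permutes {..<length ys}" "permute_list p ys = xs"
    using mset_eq_permutation[OF assms] by blast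
  let ?n = "length ys"
  let ?A = "mat ?n ?n (\<lambda>(i, j). f (ys ! i) (ys ! j))"
  let ?B = "mat ?n ?n (\<lambda>(i, j). ?A $$ (p i, j))"
  have p': "p permutes {0..<?n}"
    using p(1) by (simp add: lessThan_atLeast0)
  have less: "p i < ?n" if "i < ?n" for i
    using permutes_in_image[OF p(1), of i] that by simp
  have "det_on xs f = det (mat ?n ?n (\<lambda>(i, j). f (xs ! i) (xs ! j)))"
    using assms mset_eq_length[OF assms] by (simp add: det_on_def)
  \<comment> \<open>A column permutation is a row permutation of the transpose, so
    \<open>det_permute_rows\<close> serves for both.\<close>
  also have "mat ?n ?n (\<lambda>(i, j). f (xs ! i) (xs ! j)) =
      transpose_mat (mat ?n ?n (\<lambda>(i, j). transpose_mat ?B $$ (p i, j)))"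
    using less p by (intro eq_matI) (auto simp: permute_list_nth)
  also have "det \<dots> = signof p * (signof p * det ?A)"
    using p' by (subst det_transpose[of _ ?n], simp, subst det_permute_rows[of _ ?n], simp, simp,
      subst det_transpose[of _ ?n], simp, subst det_permute_rows[of _ ?n]) simp_all
  also have "\<dots> = det_on ys f"
    by (simp add: det_on_def sign_def)
  finally show ?thesis .
qed

text \<open>
  With \<open>M = [[A, B], [C, D]]\<close>, the hypothesis says \<open>C + D * G = K * (A + B * G)\<close>, which makes
  \<open>M * [[1, 0], [G, 1]] = [[1, 0], [K, 1]] * [[A + B * G, B], [0, D - K * B]]\<close>.
\<close>

lemma det_on_block:
  assumes inv: "\<And>x y. x \<in> set xs \<Longrightarrow> y \<in> set ys \<Longrightarrow>
    f (j y) (i x) + (\<Sum>z\<leftarrow>ys. f (j y) (j z) * g z x) =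
    (\<Sum>w\<leftarrow>xs. k y w * (f (i w) (i x) + (\<Sum>z\<leftarrow>ys. f (i w) (j z) * g z x)))"
  shows "det_on (map i xs @ map j ys) f =
    det_on xs (\<lambda>x x'. f (i x) (i x') + (\<Sum>z\<leftarrow>ys. f (i x) (j z) * g z x')) *
    det_on ys (\<lambda>y y'. f (j y) (j y') - (\<Sum>w\<leftarrow>xs. k y w * f (i w) (j y')))"
proof -
  let ?n = "length xs" and ?m = "length ys"
  define A where "A = mat ?n ?n (\<lambda>(a, b). f (i (xs ! a)) (i (xs ! b)))"
  define B where "B = mat ?n ?m (\<lambda>(a, b). f (i (xs ! a)) (j (ys ! b)))"
  define C where "C = mat ?m ?n (\<lambda>(a, b). f (j (ys ! a)) (i (xs ! b)))"
  define D where "D = mat ?m ?m (\<lambda>(a, b). f (j (ys ! a)) (j (ys ! b)))"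
  define G where "G = mat ?m ?n (\<lambda>(a, b). g (ys ! a) (xs ! b))"
  define K where "K = mat ?m ?n (\<lambda>(a, b). k (ys ! a) (xs ! b))"
  have [simp]: "A \<in> carrier_mat ?n ?n" "B \<in> carrier_mat ?n ?m" "C \<in> carrier_mat ?m ?n"
    "D \<in> carrier_mat ?m ?m" "G \<in> carrier_mat ?m ?n" "K \<in> carrier_mat ?m ?n"
    by (auto simp: A_def B_def C_def D_def G_def K_def)
  have ABG: "A + B * G = mat ?n ?n (\<lambda>(a, b). f (i (xs ! a)) (i (xs ! b)) +
      (\<Sum>z\<leftarrow>ys. f (i (xs ! a)) (j z) * g z (xs ! b)))"
    by (intro eq_matI) (auto simp: A_def B_def G_def scalar_prod_def sum_list_sum_nth)
  have DKB: "D - K * B = mat ?m ?m (\<lambda>(a, b). f (j (ys ! a)) (j (ys ! b)) -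
      (\<Sum>w\<leftarrow>xs. k (ys ! a) w * f (i w) (j (ys ! b))))"
    by (intro eq_matI) (auto simp: D_def B_def K_def scalar_prod_def sum_list_sum_nth)
  have [simp]: "A + B * G \<in> carrier_mat ?n ?n" "D - K * B \<in> carrier_mat ?m ?m"
    by (simp_all add: ABG DKB)
  have CDG: "C + D * G = K * (A + B * G)"
    unfolding ABG using inv
    by (intro eq_matI) (auto simp: C_def D_def G_def K_def scalar_prod_def sum_list_sum_nth)
  have "det_on (map i xs @ map j ys) f = det (four_block_mat A B C D)"
    unfolding det_on_def
    by (intro arg_cong[where f = det] eq_matI)
      (auto simp: A_def B_def C_def D_def nth_append)
  \<comment> \<open>The extra factor performs the column operation; it is unit lower triangular,
    hence of determinant 1.\<close>
  also have "\<dots> = det (four_block_mat A B C D) *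
      det (four_block_mat (1\<^sub>m ?n) (0\<^sub>m ?n ?m) G (1\<^sub>m ?m))"
    by (subst det_four_block_mat_upper_right_zero[of "1\<^sub>m ?n" ?n _ ?m]) auto
  also have "\<dots> = det (four_block_mat A B C D *
      four_block_mat (1\<^sub>m ?n) (0\<^sub>m ?n ?m) G (1\<^sub>m ?m))"
    by (rule det_mult[symmetric, of _ "?n + ?m"]) auto
  also have "four_block_mat A B C D * four_block_mat (1\<^sub>m ?n) (0\<^sub>m ?n ?m) G (1\<^sub>m ?m) =
      four_block_mat (A + B * G) B (C + D * G) D"
    by (subst mult_four_block_mat[of _ ?n ?n _ ?m _ ?m _ _ ?n _ ?m])
      (auto simp: right_mult_one_mat[of _ ?n ?n] right_mult_one_mat[of _ ?m ?n]
        right_mult_one_mat[of _ ?m ?m] right_mult_one_mat[of _ ?n ?m]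
        right_mult_zero_mat[of _ ?n ?n] right_mult_zero_mat[of _ ?m ?n]
        left_add_zero_mat[of _ ?n ?m] left_add_zero_mat[of _ ?m ?m])
  also have "\<dots> = four_block_mat (1\<^sub>m ?n) (0\<^sub>m ?n ?m) K (1\<^sub>m ?m) *
      four_block_mat (A + B * G) B (0\<^sub>m ?m ?n) (D - K * B)"
  proof -
    have factor: "four_block_mat P B (K * P) (K * B + R) =
        four_block_mat (1\<^sub>m ?n) (0\<^sub>m ?n ?m) K (1\<^sub>m ?m) * four_block_mat P B (0\<^sub>m ?m ?n) R"
      if [simp]: "P \<in> carrier_mat ?n ?n" "R \<in> carrier_mat ?m ?m" for P R
      by (subst mult_four_block_mat[of _ ?n ?n _ ?m _ ?m _ _ ?n _ ?m])
        (auto simp: left_mult_one_mat[of _ ?n ?n] left_mult_one_mat[of _ ?n ?m]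
          left_mult_one_mat[of _ ?m ?m] left_mult_zero_mat[of _ ?m ?m]
          right_mult_zero_mat[of _ ?m ?m] right_add_zero_mat[of _ ?n ?n]
          right_add_zero_mat[of _ ?n ?m] right_add_zero_mat[of _ ?m ?n] mult_carrier_mat[of _ ?m ?n])
    have "D = K * B + (D - K * B)"
      by (intro eq_matI) (auto simp: D_def K_def B_def)
    then show ?thesis
      using factor[of "A + B * G" "D - K * B"] by (simp add: CDG)
  qed
  also have "det \<dots> = det (four_block_mat (1\<^sub>m ?n) (0\<^sub>m ?n ?m) K (1\<^sub>m ?m)) *
      det (four_block_mat (A + B * G) B (0\<^sub>m ?m ?n) (D - K * B))"
    by (rule det_mult[of _ "?n + ?m"]) auto
  also have "\<dots> = det (A + B * G) * det (D - K * B)"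
    by (subst det_four_block_mat_upper_right_zero[of "1\<^sub>m ?n" ?n _ ?m], simp, simp, simp, simp,
      subst det_four_block_mat_lower_left_zero[of _ ?n _ ?m]) auto
  finally show ?thesis
    unfolding ABG DKB det_on_def .
qed

section \<open>Block diagonal determinants and determinants of \<open>b * I + c * J\<close>\<close>

lemma det_on_Nil [simp]: "det_on [] f = 1"
  by (simp add: det_on_def)

lemma det_on_singleton [simp]: "det_on [x] f = f x x"
  unfolding det_on_def by (subst det_single) auto

text \<open>The lower left block is already zero, so \<open>det_on_block\<close> applies with zero
  multipliers.\<close>

lemma det_on_append:
  assumes "\<And>x y. x \<in> set xs \<Longrightarrow> y \<in> set ys \<Longrightarrow> f y x = 0"
  shows "det_on (xs @ ys) f = det_on xs f * det_on ys f"
  using det_on_block[of xs ys f id id "\<lambda>_ _. 0" "\<lambda>_ _. 0"] assms by simp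

lemma det_on_diag:
  assumes "distinct xs"
  shows "det_on xs (\<lambda>x y. if x = y then a else 0) = a ^ length xs"
  using assms
proof (induction xs)
  case (Cons x xs)
  let ?f = "\<lambda>x y. if x = y then a else 0"
  have "det_on ([x] @ xs) ?f = det_on [x] ?f * det_on xs ?f"
    using Cons.prems by (intro det_on_append) auto
  then show ?case using Cons by simp
qed simp

text \<open>Adding all columns to the first makes that column constantly \<open>c\<close>;
  subtracting the first row from the others then clears it below the top. Hence both multipliers in
  \<open>det_on_block\<close> are 1.\<close>

lemma det_on_Cons_row_sums:
  assumes "\<And>y. y \<in> set (x # xs) \<Longrightarrow> (\<Sum>z\<leftarrow>x # xs. f y z) = c"
  shows "det_on (x # xs) f = c * det_on xs (\<lambda>y z. f y z - f x z)"
  using det_on_block[of "[x]" xs f id id "\<lambda>_ _. 1" "\<lambda>_ _. 1"] assms by simp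

text \<open>All rows have the same sum, which splits off as a factor; subtracting the first row
  cancels the constant part and leaves \<open>b\<close> times an identity matrix with one row
  fewer.\<close>

lemma det_on_scalar_plus_const:
  assumes "distinct xs" "xs \<noteq> []"
  shows "det_on xs (\<lambda>x y. (if x = y then b else 0) + c) =
    b ^ (length xs - 1) * (b + of_nat (length xs) * c)"
proof -
  let ?f = "\<lambda>x y. (if x = y then b else 0) + c"
  obtain x ys where xs: "xs = x # ys" using assms(2) by (cases xs) auto
  have sums: "(\<Sum>z\<leftarrow>x # ys. ?f y z) = b + of_nat (length xs) * c" if "y \<in> set (x # ys)" for y
    using that assms(1) unfolding xs[symmetric]
    by (simp add: sum_list_distinct_conv_sum_set sum.distrib distinct_card)
  have "det_on xs ?f = (b + of_nat (length xs) * c) * det_on ys (\<lambda>y z. ?f y z - ?f x z)"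
    unfolding xs using sums unfolding xs by (rule det_on_Cons_row_sums)
  also have "det_on ys (\<lambda>y z. ?f y z - ?f x z) = det_on ys (\<lambda>y z. if y = z then b else 0)"
    using assms(1) unfolding xs by (intro det_on_cong) auto
  also have "\<dots> = b ^ length ys"
    using assms(1) unfolding xs by (intro det_on_diag) auto
  finally show ?thesis by (simp add: xs)
qed

text \<open>\<open>List.product\<close> runs through the pairs edge by edge, so the matrix is block
  diagonal with one copy of \<open>g\<close> per edge, and \<open>det_on_append\<close> peels off
  the blocks in turn.\<close>

lemma det_on_product:
  assumes "distinct es"
  shows "det_on (List.product es ws) (\<lambda>(e, w) (e', w'). if e = e' then g w w' else 0) =
    det_on ws g ^ length es"
  using assms
proof (induction es)
  case (Cons e es)
  let ?f = "\<lambda>(e, w) (e', w'). if e = e' then g w w' else 0"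
  have "det_on (List.product (e # es) ws) ?f =
      det_on (map (Pair e) ws) ?f * det_on (List.product es ws) ?f"
    using Cons.prems by (simp, intro det_on_append) auto
  then show ?case using Cons by (simp add: det_on_map)
qed simp

section \<open>The determinant of a base with pockets\<close>

lemma sum_list_product:
  "(\<Sum>z\<leftarrow>List.product xs ys. f z) = (\<Sum>x\<leftarrow>xs. \<Sum>y\<leftarrow>ys. f (x, y))"
  by (induction xs) (auto simp: o_def)

lemma sum_list_delta:
  fixes f :: "'a \<Rightarrow> 'b :: comm_monoid_add"
  assumes "distinct xs" "x \<in> set xs"
  shows "(\<Sum>z\<leftarrow>xs. if z = x then f z else 0) = f x"
    and "(\<Sum>z\<leftarrow>xs. if x = z then f z else 0) = f x"
  by (simp_all add: sum_list_distinct_conv_sum_set[OF assms(1)] assms(2))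

text \<open>The entry pattern of \<open>x * I - Q\<close> shared by \<open>G\<close> and, with a
  single edge, by \<open>H\<close>. The label \<open>(b, e)\<close> is an end of \<open>e\<close>,
  the label \<open>(e, w)\<close> a pocket vertex, and \<open>i\<close>, \<open>j\<close> turn
  labels into vertices. The diagonal entry at an end is \<open>a - 1\<close>.\<close>

lemma det_on_pockets:
  fixes f :: "'v \<Rightarrow> 'v \<Rightarrow> 'c :: field"
  assumes es: "distinct es" "es \<noteq> []" and c: "c \<noteq> 0"
    and base: "\<And>e e' b b'. e \<in> set es \<Longrightarrow> e' \<in> set es \<Longrightarrow>
      f (i (b, e)) (i (b', e')) = (if b = b' \<and> e = e' then a else 0) - 1"
    and base_pocket: "\<And>e e' b w. e \<in> set es \<Longrightarrow> e' \<in> set es \<Longrightarrow> w \<in> set ws \<Longrightarrow>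
      f (i (b, e)) (j (e', w)) = (if e = e' then - 1 else 0)"
    and pocket_base: "\<And>e e' b w. e \<in> set es \<Longrightarrow> e' \<in> set es \<Longrightarrow> w \<in> set ws \<Longrightarrow>
      f (j (e', w)) (i (b, e)) = (if e' = e then - 1 else 0)"
    and pocket: "\<And>e e' w w'. e \<in> set es \<Longrightarrow> e' \<in> set es \<Longrightarrow> w \<in> set ws \<Longrightarrow> w' \<in> set ws \<Longrightarrow>
      f (j (e, w)) (j (e', w')) = (if e = e' then g w w' else 0)"
    and row_sums: "\<And>w. w \<in> set ws \<Longrightarrow> (\<Sum>w'\<leftarrow>ws. g w w') = c"
    and d: "d = of_nat (length ws) / c"
  shows "det_on (map i (map (Pair False) es @ map (Pair True) es) @ map j (List.product es ws)) f =
    a ^ length es * ((a - 2 * d) ^ (length es - 1) * (a - 2 * d - 2 * of_nat (length es))) *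
    det_on ws g ^ length es"
proof -
  let ?xs = "map (Pair False) es @ map (Pair True) es"
  let ?ys = "List.product es ws"
  \<comment> \<open>Column multipliers: each end receives \<open>1 / c\<close> times every column of
    its own pocket.\<close>
  let ?G = "\<lambda>(e', w) (b :: bool, e). if e' = e then 1 / c else 0"
  \<comment> \<open>The base block after that operation. The row of an end has \<open>- 1\<close> at
    each of the \<open>length ws\<close> vertices of its pocket, so \<open>- d\<close> is added in
    the columns of both ends of its edge.\<close>
  let ?S = "\<lambda>(b, e) (b', e'). (if b = b' \<and> e = e' then a else 0) - 1 - (if e = e' then d else 0)"
  have col_pocket: "f (j y) (i x) + (\<Sum>z\<leftarrow>?ys. f (j y) (j z) * ?G z x) = 0"
    if xy: "x \<in> set ?xs" "y \<in> set ?ys" for x y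
  proof -
    obtain b e where x: "x = (b, e)" "e \<in> set es" by (cases x) (use xy(1) in auto)
    obtain e' w where y: "y = (e', w)" "e' \<in> set es" "w \<in> set ws" using xy(2) by auto
    have "(\<Sum>z\<leftarrow>?ys. f (j y) (j z) * ?G z x) =
        (\<Sum>e''\<leftarrow>es. if e'' = e then (\<Sum>w'\<leftarrow>ws. (if e' = e'' then g w w' else 0)) / c else 0)"
      unfolding sum_list_product x y using y
      by (intro arg_cong[where f = sum_list] map_cong)
        (auto simp: pocket sum_list_const_mult sum_list_mult_const divide_inverse cong: map_cong)
    also have "\<dots> = (if e' = e then 1 else 0)"
      using row_sums[OF y(3)] c by (simp add: sum_list_delta[OF es(1) x(2)])
    finally show ?thesis using x y by (simp add: pocket_base)
  qed
  \<comment> \<open>With the lower left block cleared, the row multipliers are zero and the pocket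
    block stays as it is.\<close>
  have "det_on (map i ?xs @ map j ?ys) f =
      det_on ?xs (\<lambda>x x'. f (i x) (i x') + (\<Sum>z\<leftarrow>?ys. f (i x) (j z) * ?G z x')) *
      det_on ?ys (\<lambda>y y'. f (j y) (j y'))"
    using det_on_block[of ?xs ?ys f j i ?G "\<lambda>_ _. 0"] col_pocket
    by (simp only: mult_zero_left sum_list_0 diff_0_right)
  also have "det_on ?ys (\<lambda>y y'. f (j y) (j y')) =
      det_on ?ys (\<lambda>(e, w) (e', w'). if e = e' then g w w' else 0)"
    by (rule det_on_cong) (auto simp: pocket)
  also have "\<dots> = det_on ws g ^ length es"
    by (rule det_on_product[OF es(1)])
  also have "det_on ?xs (\<lambda>x x'. f (i x) (i x') + (\<Sum>z\<leftarrow>?ys. f (i x) (j z) * ?G z x')) =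
      det_on ?xs ?S"
  proof (rule det_on_cong)
    fix x x' assume xx': "x \<in> set ?xs" "x' \<in> set ?xs"
    obtain b e b' e' where x: "x = (b, e)" "e \<in> set es" "x' = (b', e')" "e' \<in> set es"
      by (cases x, cases x') (use xx' in auto)
    have "(\<Sum>z\<leftarrow>?ys. f (i x) (j z) * ?G z x') =
        (\<Sum>e''\<leftarrow>es. if e'' = e' then (if e = e'' then - d else 0) else 0)"
      unfolding sum_list_product x using x
      by (intro arg_cong[where f = sum_list] map_cong)
        (auto simp: base_pocket d sum_list_triv cong: map_cong)
    also have "\<dots> = (if e = e' then - d else 0)"
      by (simp add: sum_list_delta[OF es(1) x(4)])
    finally show "f (i x) (i x') + (\<Sum>z\<leftarrow>?ys. f (i x) (j z) * ?G z x') = ?S x x'"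
      using x by (simp add: base)
  qed
  also have "\<dots> = det_on es (\<lambda>e e'. (if e = e' then a - 2 * d else 0) + - 2) *
      det_on es (\<lambda>e e'. if e = e' then a else 0)"
  proof -
    let ?\<delta> = "\<lambda>e e'. if e = e' then 1 else 0 :: 'c"
    have delta: "(\<Sum>z\<leftarrow>es. F z * (if z = e then 1 else 0)) = F e"
      "(\<Sum>z\<leftarrow>es. (if e = z then 1 else 0) * F z) = F e" if "e \<in> set es" for e and F :: "_ \<Rightarrow> 'c"
    proof -
      have "(\<Sum>z\<leftarrow>es. F z * (if z = e then 1 else 0)) = (\<Sum>z\<leftarrow>es. if z = e then F z else 0)"
        "(\<Sum>z\<leftarrow>es. (if e = z then 1 else 0) * F z) = (\<Sum>z\<leftarrow>es. if e = z then F z else 0)"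
        by (intro arg_cong[where f = sum_list] map_cong; simp)+
      then show "(\<Sum>z\<leftarrow>es. F z * (if z = e then 1 else 0)) = F e"
        "(\<Sum>z\<leftarrow>es. (if e = z then 1 else 0) * F z) = F e"
        using sum_list_delta[OF es(1) that] by simp_all
    qed
    \<comment> \<open>The shape \<open>[[X, Y], [Y, X]]\<close>: identity multipliers add the second
      block column to the first and subtract the first block row from the second. This leaves
      \<open>X + Y = (a - 2 * d) * I - 2 * J\<close> and \<open>X - Y = a * I\<close>.\<close>
    have "det_on ?xs ?S =
        det_on es (\<lambda>x x'. ?S (False, x) (False, x') + (\<Sum>z\<leftarrow>es. ?S (False, x) (True, z) * ?\<delta> z x')) *
        det_on es (\<lambda>y y'. ?S (True, y) (True, y') - (\<Sum>w\<leftarrow>es. ?\<delta> y w * ?S (False, w) (True, y')))"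
      by (rule det_on_block) (simp only: delta, simp)
    also have "det_on es (\<lambda>x x'. ?S (False, x) (False, x') + (\<Sum>z\<leftarrow>es. ?S (False, x) (True, z) * ?\<delta> z x')) =
        det_on es (\<lambda>e e'. (if e = e' then a - 2 * d else 0) + - 2)"
      by (rule det_on_cong) (simp only: delta, simp)
    also have "det_on es (\<lambda>y y'. ?S (True, y) (True, y') - (\<Sum>w\<leftarrow>es. ?\<delta> y w * ?S (False, w) (True, y'))) =
        det_on es (\<lambda>e e'. if e = e' then a else 0)"
      by (rule det_on_cong) (simp only: delta, simp)
    finally show ?thesis .
  qed
  finally show ?thesis
    unfolding det_on_scalar_plus_const[OF es] det_on_diag[OF es(1)] by (simp add: mult_ac)
qed

section \<open>Signless Laplacian entries\<close>

text \<open>Entries are indexed by vertices, independently of any enumeration, and are complex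
  because the spectrum is.\<close>

definition signless_entry :: "'a graph \<Rightarrow> 'a \<Rightarrow> 'a \<Rightarrow> complex" where
  "signless_entry X a b =
    (if a = b then of_nat (degree_of X a) else 0) + (if {a, b} \<in> edges X then 1 else 0)"

text \<open>Evaluation at a number keeps the determinant over a field, where division by the pocket
  row sum is possible.\<close>

lemma poly_char_poly_mat:
  fixes M :: "'a \<Rightarrow> 'a \<Rightarrow> 'c :: field"
  assumes "distinct xs"
  shows "poly (char_poly (mat (length xs) (length xs) (\<lambda>(i, j). M (xs ! i) (xs ! j)))) x =
    det_on xs (\<lambda>a b. (if a = b then x else 0) - M a b)"
  unfolding det_on_def
  by (subst char_poly_matrix[of _ "length xs"], simp, intro arg_cong[where f = det] eq_matI)
    (auto simp: char_matrix_def nth_eq_iff_index_eq[OF assms])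

lemma map_mat_signless_laplacian:
  assumes "distinct xs"
  shows "map_mat complex_of_real (signless_laplacian xs X) =
    mat (length xs) (length xs) (\<lambda>(i, j). signless_entry X (xs ! i) (xs ! j))"
  by (intro eq_matI)
    (auto simp: signless_laplacian_def degree_matrix_def adjacency_matrix_def signless_entry_def
      nth_eq_iff_index_eq[OF assms])

text \<open>Each edge at \<open>x\<close> has exactly one other end, so \<open>y\<close> and
  \<open>{x, y}\<close> correspond bijectively.\<close>

lemma degree_of_eq_card_neighbours:
  assumes "simple_graph X"
  shows "degree_of X x = card {y. {x, y} \<in> edges X}"
proof -
  have "bij_betw (\<lambda>y. {x, y}) {y. {x, y} \<in> edges X} {e \<in> edges X. x \<in> e}"
  proof (rule bij_betw_imageI)
    show "inj_on (\<lambda>y. {x, y}) {y. {x, y} \<in> edges X}"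
      by (auto simp: inj_on_def doubleton_eq_iff)
    show "(\<lambda>y. {x, y}) ` {y. {x, y} \<in> edges X} = {e \<in> edges X. x \<in> e}"
    proof safe
      fix e assume e: "e \<in> edges X" "x \<in> e"
      then have "card e = 2" using assms by (auto simp: simple_graph_def)
      then obtain y where "e = {x, y}" using e(2) by (auto simp: card_2_iff)
      then show "e \<in> (\<lambda>y. {x, y}) ` {y. {x, y} \<in> edges X}" using e by auto
    qed
  qed
  then show ?thesis unfolding degree_of_def by (rule bij_betw_same_card[symmetric])
qed

text \<open>Multiplication by the linear factor at \<open>z\<close> hides the exceptional point, and
  the factor cancels afterwards. This removes the value of \<open>x\<close> at which the pocket row
  sum vanishes.\<close>

lemma poly_eqI_off_point:
  fixes p q :: "'a :: field_char_0 poly"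
  assumes "\<And>x. x \<noteq> z \<Longrightarrow> poly p x = poly q x"
  shows "p = q"
proof -
  have "[:- z, 1:] * p = [:- z, 1:] * q"
  proof (rule poly_ext)
    fix x show "poly ([:- z, 1:] * p) x = poly ([:- z, 1:] * q) x"
      using assms[of x] by (cases "x = z") simp_all
  qed
  then show ?thesis by (simp del: mult_pCons_left)
qed

section \<open>Complete graphs with matched edge-pockets\<close>

locale edge_pockets =
  fixes F :: "'a graph" and H :: "'b graph" and E :: "'a set set"
    and u v :: 'b and s t :: "'a set \<Rightarrow> 'a" and k m r :: nat
  assumes k: "k \<ge> 1" and F: "complete_graph (2 * k) F"
    and E: "E \<subseteq> edges F" "card E = k" and matching: "perfect_matching F (edge_induced E)"
    and H: "simple_graph H" "card (verts H) = m" "m \<ge> 3"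
    and uv: "{u, v} \<in> edges H" "degree_of H u = m - 1" "degree_of H v = m - 1"
    and regular: "regular_graph r (delete_verts H {u, v})"
    and st: "\<And>e. e \<in> E \<Longrightarrow> e = {s e, t e}"
begin

section \<open>Adjacency and degrees in \<open>H\<close>\<close>

text \<open>The interior of a pocket, that is, the vertex set of \<open>H_2\<close>; only these
  vertices of a copy are new after pasting.\<close>

definition W :: "'b set" where "W = verts H - {u, v}"

definition pocket_graph :: "('a + 'a set \<times> 'b) graph" where "pocket_graph = edge_pocket_graph F E s t H u v"

lemma finite_verts_H: "finite (verts H)"
  using H(1) by (simp add: simple_graph_def)

lemma edge_H: "e \<in> edges H \<Longrightarrow> e \<subseteq> verts H \<and> card e = 2"
  using H(1) by (simp add: simple_graph_def)

lemma u_neq_v: "u \<noteq> v" and uv_verts: "u \<in> verts H" "v \<in> verts H"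
  using edge_H[OF uv(1)] by (auto simp: card_2_iff)

lemma no_loops_H: "{w} \<notin> edges H"
  using edge_H[of "{w}"] by auto

lemma finite_W: "finite W"
  by (simp add: W_def finite_verts_H)

lemma card_W: "card W = m - 2"
  using finite_verts_H uv_verts u_neq_v H(2) by (simp add: W_def card_Diff_subset)

lemma verts_H: "verts H = insert u (insert v W)" "u \<notin> W" "v \<notin> W"
  using uv_verts by (auto simp: W_def)

text \<open>The neighbours form a subset of the \<open>m - 1\<close> other vertices, and the degree
  says that they fill it.\<close>

lemma dominating_neighbours:
  assumes "x \<in> verts H" "degree_of H x = m - 1"
  shows "{y. {x, y} \<in> edges H} = verts H - {x}"
proof (rule card_subset_eq)
  show "{y. {x, y} \<in> edges H} \<subseteq> verts H - {x}"
    using edge_H no_loops_H by auto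
  show "card {y. {x, y} \<in> edges H} = card (verts H - {x})"
    using assms H(2) finite_verts_H degree_of_eq_card_neighbours[OF H(1), of x] by simp
qed (simp add: finite_verts_H)

lemma edge_u: "{u, w} \<in> edges H \<longleftrightarrow> w = v \<or> w \<in> W"
  using dominating_neighbours[OF uv_verts(1) uv(2)] u_neq_v verts_H by blast

lemma edge_v: "{v, w} \<in> edges H \<longleftrightarrow> w = u \<or> w \<in> W"
  using dominating_neighbours[OF uv_verts(2) uv(3)] u_neq_v verts_H by blast

text \<open>For \<open>w\<close> in \<open>W\<close> this is the neighbourhood in
  \<open>H_2\<close>.\<close>

definition N :: "'b \<Rightarrow> 'b set" where "N w = {w' \<in> W. {w, w'} \<in> edges H}"

lemma finite_N: "finite (N w)"
  by (simp add: N_def finite_W)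

lemma card_N:
  assumes "w \<in> W"
  shows "card (N w) = r"
proof -
  let ?H = "delete_verts H {u, v}"
  have "simple_graph ?H"
    using H(1) by (auto simp: simple_graph_def delete_verts_def)
  from degree_of_eq_card_neighbours[OF this, of w]
  have "card {w'. {w, w'} \<in> edges ?H} = r"
    using regular assms by (simp add: regular_graph_def delete_verts_def W_def)
  also have "{w'. {w, w'} \<in> edges ?H} = N w"
    using assms edge_H by (auto simp: N_def delete_verts_def W_def)
  finally show ?thesis .
qed

lemma degree_H:
  assumes "w \<in> W"
  shows "degree_of H w = r + 2"
proof -
  have "{w'. {w, w'} \<in> edges H} = insert u (insert v (N w))"
    using edge_u[of w] edge_v[of w] assms edge_H by (auto simp: N_def W_def insert_commute)
  then show ?thesis
    using degree_of_eq_card_neighbours[OF H(1), of w] card_N[OF assms] finite_N[of w] u_neq_v verts_H(2,3)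
    by (simp add: N_def)
qed

section \<open>The complete base and its perfect matching\<close>

lemma edges_F: "edges F = {e. e \<subseteq> verts F \<and> card e = 2}"
  and finite_verts_F: "finite (verts F)" and card_verts_F: "card (verts F) = 2 * k"
  using F by (simp_all add: complete_graph_def)

lemma edge_F: "{x, y} \<in> edges F \<longleftrightarrow> x \<in> verts F \<and> y \<in> verts F \<and> x \<noteq> y"
  by (auto simp: edges_F card_2_iff doubleton_eq_iff)

lemma finite_E: "finite E"
  \<comment> \<open>An infinite set would have \<open>card\<close> 0, contrary to
    \<open>k \<ge> 1\<close>.\<close>
  using k E(2) card.infinite by fastforce

lemma st_E:
  assumes "e \<in> E"
  shows "s e \<noteq> t e" "s e \<in> verts F" "t e \<in> verts F"
proof -
  have "{s e, t e} \<in> edges F"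
    using st[OF assms] E(1) assms by auto
  then show "s e \<noteq> t e" "s e \<in> verts F" "t e \<in> verts F"
    by (simp_all add: edge_F)
qed

lemma card_matching_edges:
  assumes "x \<in> verts F"
  shows "card {e \<in> E. x \<in> e} = 1"
proof -
  have "x \<in> \<Union>E"
    using matching assms by (simp add: perfect_matching_def edge_induced_def)
  then show ?thesis
    using matching
    by (auto simp: perfect_matching_def edge_induced_def regular_graph_def degree_of_def)
qed

lemma matching_edge_unique:
  assumes "e \<in> E" "e' \<in> E" "x \<in> e" "x \<in> e'"
  shows "e = e'"
proof -
  have "x \<in> verts F" using assms(1,3) E(1) by (auto simp: edges_F)
  then obtain e0 where e0: "{e \<in> E. x \<in> e} = {e0}"
    using card_matching_edges card_1_singletonE by metis
  have "e \<in> {e \<in> E. x \<in> e}" "e' \<in> {e \<in> E. x \<in> e}" using assms by simp_all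
  then show ?thesis unfolding e0 by simp
qed

text \<open>Coordinates on \<open>verts F\<close>: every vertex is the first or the second end of
  exactly one matching edge. These are the base labels of \<open>det_on_pockets\<close>.\<close>

definition end_of :: "bool \<times> 'a set \<Rightarrow> 'a" where
  "end_of = (\<lambda>(b, e). if b then t e else s e)"

lemma end_of_mem: "e \<in> E \<Longrightarrow> end_of (b, e) \<in> e"
  using st by (auto simp: end_of_def)

lemma end_of_verts: "e \<in> E \<Longrightarrow> end_of (b, e) \<in> verts F"
  using st_E by (simp add: end_of_def)

lemma end_of_mem_iff: "e \<in> E \<Longrightarrow> e' \<in> E \<Longrightarrow> end_of (b, e) \<in> e' \<longleftrightarrow> e = e'"
  using matching_edge_unique end_of_mem by blast

lemma end_of_eq_iff:
  assumes "e \<in> E" "e' \<in> E"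
  shows "end_of (b, e) = end_of (b', e') \<longleftrightarrow> b = b' \<and> e = e'"
  using assms end_of_mem_iff[OF assms, of b] end_of_mem[OF assms(2), of b'] st_E(1)[OF assms(1)]
  by (auto simp: end_of_def split: if_splits)

lemma range_end_of: "end_of ` (UNIV \<times> E) = verts F"
proof
  show "end_of ` (UNIV \<times> E) \<subseteq> verts F" using end_of_verts by auto
  show "verts F \<subseteq> end_of ` (UNIV \<times> E)"
  proof
    fix x assume "x \<in> verts F"
    then obtain e where e: "e \<in> E" "x \<in> e"
      using card_matching_edges[of x] by (auto simp: card_1_singleton_iff)
    then have "x = s e \<or> x = t e" using st by blast
    then have "x = end_of (False, e) \<or> x = end_of (True, e)" by (simp add: end_of_def)
    then show "x \<in> end_of ` (UNIV \<times> E)" using e by blast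
  qed
qed

section \<open>Vertices, edges and degrees of the pasted graph\<close>

lemma verts_G: "verts pocket_graph = Inl ` verts F \<union> Inr ` (E \<times> W)"
  using st_E(2,3) by (auto simp: pocket_graph_def edge_pocket_graph_def pocket_map_def W_def)

lemma pocket_map_simps:
  "pocket_map s t u v e u = Inl (s e)" "pocket_map s t u v e v = Inl (t e)"
  "w \<in> W \<Longrightarrow> pocket_map s t u v e w = Inr (e, w)"
  using u_neq_v by (auto simp: pocket_map_def W_def)

lemma edges_H_cases:
  assumes "d \<in> edges H"
  obtains "d = {u, v}" | w where "w \<in> W" "d = {u, w}" | w where "w \<in> W" "d = {v, w}"
    | w w' where "w \<in> W" "w' \<in> W" "w \<noteq> w'" "d = {w, w'}"
proof -
  obtain a b where d: "d = {a, b}" "a \<noteq> b" and "a \<in> verts H" "b \<in> verts H"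
    using edge_H[OF assms] by (auto simp: card_2_iff)
  then have "a = u \<or> a = v \<or> a \<in> W" "b = u \<or> b = v \<or> b \<in> W"
    by (simp_all add: verts_H)
  then show thesis
    using that(1) that(2)[of a] that(2)[of b] that(3)[of a] that(3)[of b] that(4)[of a b] d
    by (elim disjE) (simp_all add: insert_commute)
qed

text \<open>The pasted edge \<open>uv\<close> already lies in \<open>F\<close>. Since
  \<open>u\<close> and \<open>v\<close> both dominate \<open>H\<close>, a pocket vertex sees both
  ends of its edge, so the orientation given by \<open>s\<close> and \<open>t\<close>
  disappears.\<close>

lemma edges_G: "edges pocket_graph =
    {{Inl x, Inl y} | x y. x \<in> verts F \<and> y \<in> verts F \<and> x \<noteq> y} \<union>
    {{Inl x, Inr (e, w)} | x e w. e \<in> E \<and> w \<in> W \<and> x \<in> e} \<union>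
    {{Inr (e, w), Inr (e, w')} | e w w'. e \<in> E \<and> w \<in> W \<and> w' \<in> W \<and> {w, w'} \<in> edges H}"
    (is "_ = ?A \<union> ?B \<union> ?C")
proof
  have edges_eq: "edges pocket_graph = (\<lambda>d. Inl ` d) ` edges F \<union>
      (\<Union>e\<in>E. (\<lambda>d. pocket_map s t u v e ` d) ` edges H)"
    by (simp add: pocket_graph_def edge_pocket_graph_def)
  have F_edges: "(\<lambda>d. Inl ` d) ` edges F \<subseteq> ?A"
    by (auto simp: edges_F card_2_iff)
  have H_edges: "pocket_map s t u v e ` d \<in> ?A \<union> ?B \<union> ?C" if e: "e \<in> E" and d: "d \<in> edges H" for e d
    using d
  proof (cases rule: edges_H_cases)
    case 1
    then show ?thesis using st_E[OF e] by (auto simp: pocket_map_simps)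
  next
    case (2 w)
    then show ?thesis using st[OF e] e by (auto simp: pocket_map_simps)
  next
    case (3 w)
    then show ?thesis using st[OF e] e by (auto simp: pocket_map_simps)
  next
    case (4 w w')
    then show ?thesis using d e by (auto simp: pocket_map_simps)
  qed
  show "edges pocket_graph \<subseteq> ?A \<union> ?B \<union> ?C"
    unfolding edges_eq
  proof (rule Un_least)
    show "(\<lambda>d. Inl ` d) ` edges F \<subseteq> ?A \<union> ?B \<union> ?C"
      using F_edges by (intro le_supI1)
    show "(\<Union>e\<in>E. (\<lambda>d. pocket_map s t u v e ` d) ` edges H) \<subseteq> ?A \<union> ?B \<union> ?C"
      by (intro UN_least image_subsetI H_edges)
  qed
  have "?A \<subseteq> edges pocket_graph"
  proof
    fix d assume "d \<in> ?A"
    then obtain x y where "d = Inl ` {x, y}" "{x, y} \<in> edges F"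
      by (auto simp: edge_F)
    then show "d \<in> edges pocket_graph" unfolding edges_eq by blast
  qed
  moreover have pocket_edge: "pocket_map s t u v e ` d \<in> edges pocket_graph" if "e \<in> E" "d \<in> edges H" for e d
    using that unfolding edges_eq by auto
  have "?B \<subseteq> edges pocket_graph"
  proof
    fix d assume "d \<in> ?B"
    then obtain x e w where d: "d = {Inl x, Inr (e, w)}" and e: "e \<in> E" and w: "w \<in> W" and "x \<in> e"
      by blast
    then have "x = s e \<or> x = t e" using st[OF e] by blast
    then show "d \<in> edges pocket_graph"
      using pocket_edge[OF e, of "{u, w}"] pocket_edge[OF e, of "{v, w}"] w d
      by (auto simp: pocket_map_simps edge_u edge_v)
  qed
  moreover have "?C \<subseteq> edges pocket_graph"
  proof
    fix d assume "d \<in> ?C"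
    then obtain e w w' where d: "d = {Inr (e, w), Inr (e, w')}" and e: "e \<in> E"
      and w: "w \<in> W" "w' \<in> W" "{w, w'} \<in> edges H"
      by blast
    then show "d \<in> edges pocket_graph"
      using pocket_edge[OF e w(3)] by (simp add: pocket_map_simps)
  qed
  ultimately show "?A \<union> ?B \<union> ?C \<subseteq> edges pocket_graph" by (intro Un_least)
qed

lemma edge_G:
  "{Inl x, Inl y} \<in> edges pocket_graph \<longleftrightarrow> x \<in> verts F \<and> y \<in> verts F \<and> x \<noteq> y"
  "{Inl x, Inr (e, w)} \<in> edges pocket_graph \<longleftrightarrow> e \<in> E \<and> w \<in> W \<and> x \<in> e"
  "{Inr (e, w), Inl x} \<in> edges pocket_graph \<longleftrightarrow> e \<in> E \<and> w \<in> W \<and> x \<in> e"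
  "{Inr (e, w), Inr (e', w')} \<in> edges pocket_graph \<longleftrightarrow>
    e = e' \<and> e \<in> E \<and> w \<in> W \<and> w' \<in> W \<and> {w, w'} \<in> edges H"
  unfolding edges_G by (auto simp: doubleton_eq_iff insert_commute)

lemma simple_graph_G: "simple_graph pocket_graph"
  unfolding simple_graph_def verts_G
proof (intro conjI ballI)
  show "finite (Inl ` verts F \<union> Inr ` (E \<times> W))"
    by (simp add: finite_verts_F finite_E finite_W)
  fix d assume "d \<in> edges pocket_graph"
  then show "d \<subseteq> Inl ` verts F \<union> Inr ` (E \<times> W)" "card d = 2"
    using E(1) no_loops_H unfolding edges_G by (auto simp: edges_F card_insert_if)
qed

lemma degree_G_base:
  assumes "x \<in> verts F"
  shows "degree_of pocket_graph (Inl x) = 2 * k - 1 + (m - 2)"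
proof -
  obtain e where e: "e \<in> E" "x \<in> e"
    using card_matching_edges[OF assms] by (auto simp: card_1_singleton_iff)
  have "{z. {Inl x, z} \<in> edges pocket_graph} = Inl ` (verts F - {x}) \<union> Inr ` ({e} \<times> W)"
  proof (rule Set.set_eqI)
    fix z show "z \<in> {z. {Inl x, z} \<in> edges pocket_graph} \<longleftrightarrow> z \<in> Inl ` (verts F - {x}) \<union> Inr ` ({e} \<times> W)"
      \<comment> \<open>For \<open>z\<close> in a pocket, \<open>fst (projr z)\<close> is the edge
        carrying that pocket; if it contains \<open>x\<close>, it must be \<open>e\<close>.\<close>
      using e assms matching_edge_unique[OF _ e(1) _ e(2), of "fst (projr z)"]
      by (cases z) (auto simp: edge_G)
  qed
  moreover have "card (Inl ` (verts F - {x}) \<union> Inr ` ({e} \<times> W)) = (2 * k - 1) + (m - 2)"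
    using assms by (subst card_Un_disjoint)
      (auto simp: finite_verts_F finite_W card_image card_verts_F card_W card_cartesian_product)
  ultimately show ?thesis
    using degree_of_eq_card_neighbours[OF simple_graph_G] by metis
qed

lemma degree_G_pocket:
  assumes "e \<in> E" "w \<in> W"
  shows "degree_of pocket_graph (Inr (e, w)) = r + 2"
proof -
  have "{z. {Inr (e, w), z} \<in> edges pocket_graph} = Inl ` e \<union> Inr ` ({e} \<times> N w)"
  proof (rule Set.set_eqI)
    fix z show "z \<in> {z. {Inr (e, w), z} \<in> edges pocket_graph} \<longleftrightarrow> z \<in> Inl ` e \<union> Inr ` ({e} \<times> N w)"
      using assms by (cases z) (auto simp: edge_G N_def)
  qed
  moreover have "card e = 2" "finite e"
    using assms E(1) by (auto simp: edges_F intro: finite_subset[OF _ finite_verts_F])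
  then have "card (Inl ` e \<union> Inr ` ({e} \<times> N w)) = 2 + r"
    using assms by (subst card_Un_disjoint)
      (auto simp: finite_N card_image card_N card_cartesian_product)
  ultimately show ?thesis
    using degree_of_eq_card_neighbours[OF simple_graph_G] by (metis add.commute)
qed

section \<open>The polynomial of a single pocket\<close>

text \<open>This concerns the principal submatrix of \<open>Q(H)\<close>, with degrees taken in
  \<open>H\<close>; when \<open>ws\<close> enumerates \<open>W\<close>, it is the characteristic
  polynomial of \<open>Q(H_2) + 2 * I\<close>.\<close>

definition pocket_char_poly :: "'b list \<Rightarrow> complex poly" where
  "pocket_char_poly ws =
     char_poly (mat (length ws) (length ws) (\<lambda>(i, j). signless_entry H (ws ! i) (ws ! j)))"

text \<open>The diagonal contributes \<open>x - (r + 2)\<close> and each of the \<open>r\<close>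
  neighbours inside the pocket contributes \<open>- 1\<close>.\<close>

lemma pocket_row_sum:
  assumes "distinct ws" "set ws = W" "w \<in> W"
  shows "(\<Sum>w'\<leftarrow>ws. (if w = w' then x else 0) - signless_entry H w w') = x - (2 * of_nat r + 2)"
proof -
  have "(\<Sum>w'\<leftarrow>ws. (if w = w' then x else 0) - signless_entry H w w') =
      (\<Sum>w'\<in>W. (if w = w' then x - of_nat (r + 2) else 0)) - (\<Sum>w'\<in>W. if {w, w'} \<in> edges H then 1 else 0)"
    using degree_H[OF assms(3)]
    by (simp add: sum_list_distinct_conv_sum_set[OF assms(1)] assms(2) sum_subtractf[symmetric] signless_entry_def)
      (intro sum.cong; auto)
  also have "(\<Sum>w'\<in>W. if {w, w'} \<in> edges H then 1 else 0) = of_nat (card (N w))"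
    by (simp add: finite_W sum.If_cases N_def Int_def)
  also have "(\<Sum>w'\<in>W. (if w = w' then x - of_nat (r + 2) else 0)) = x - of_nat (r + 2)"
    using assms(3) finite_W by simp
  finally show ?thesis using card_N[OF assms(3)] by simp
qed

lemma poly_pocket_char_poly:
  assumes "distinct ws"
  shows "poly (pocket_char_poly ws) x =
    det_on ws (\<lambda>w w'. (if w = w' then x else 0) - signless_entry H w w')"
  unfolding pocket_char_poly_def by (rule poly_char_poly_mat[OF assms])

text \<open>At \<open>2 * r + 2\<close> all row sums vanish, so the all-ones vector lies in the
  kernel. This root is what cancels the denominators later.\<close>

lemma pocket_char_poly_root:
  assumes "distinct ws" "set ws = W"
  shows "[:- (2 * of_nat r + 2), 1:] dvd pocket_char_poly ws"
proof -
  \<comment> \<open>The pocket is nonempty because \<open>m - 2 \<ge> 1\<close>.\<close>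
  obtain w ws' where ws: "ws = w # ws'"
    using assms(2) card_W H(3) by (cases ws) auto
  let ?f = "\<lambda>w w'. (if w = w' then 2 * of_nat r + 2 else 0) - signless_entry H w w'"
  have row_sums: "(\<Sum>w'\<leftarrow>w # ws'. ?f y w') = 0" if "y \<in> set (w # ws')" for y :: 'b
    using pocket_row_sum[OF assms, of y "2 * of_nat r + 2"] that unfolding ws[symmetric] assms(2)
    by simp
  have "det_on (w # ws') ?f = 0 * det_on ws' (\<lambda>y z. ?f y z - ?f w z)"
    by (rule det_on_Cons_row_sums) (rule row_sums)
  then have "poly (pocket_char_poly ws) (2 * of_nat r + 2) = 0"
    unfolding poly_pocket_char_poly[OF assms(1)] unfolding ws by (simp only: mult_zero_left)
  then show ?thesis by (simp add: poly_eq_0_iff_dvd)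
qed

section \<open>Values of the characteristic polynomials of \<open>G\<close> and
  \<open>H\<close>\<close>

text \<open>A base vertex has degree \<open>m + 2 * k - 3\<close>; \<open>a\<close> is larger by 1
  than its diagonal entry because the base block is written as \<open>a * I - J\<close>.\<close>

lemma poly_char_poly_G:
  assumes "vertex_order pocket_graph xs" "distinct ws" "set ws = W" "x \<noteq> 2 * of_nat r + 2"
  defines "a \<equiv> x - (of_nat m + 2 * of_nat k - 4)" and "d \<equiv> (of_nat m - 2) / (x - (2 * of_nat r + 2))"
  shows "poly (char_poly (map_mat complex_of_real (signless_laplacian xs pocket_graph))) x =
    a ^ k * ((a - 2 * d) ^ (k - 1) * (a - 2 * d - 2 * of_nat k)) * poly (pocket_char_poly ws) x ^ k"
proof -
  obtain es where es: "distinct es" "set es = E"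
    using finite_distinct_list[OF finite_E] by blast
  have len: "length es = k" "length ws = m - 2"
    using es assms(2,3) E(2) card_W distinct_card by metis+
  let ?i = "\<lambda>be. Inl (end_of be) :: 'a + 'a set \<times> 'b"
  \<comment> \<open>First ends, then second ends, then the pockets edge by edge: the order in which
    \<open>det_on_pockets\<close> applies.\<close>
  let ?ys = "map ?i (map (Pair False) es @ map (Pair True) es) @ map Inr (List.product es ws)"
  let ?f = "\<lambda>p q. (if p = q then x else 0) - signless_entry pocket_graph p q"
  have xs: "distinct xs" "set xs = verts pocket_graph"
    using assms(1) by (auto simp: vertex_order_def)
  have "set ?ys = verts pocket_graph"
  proof -
    have "set (map (Pair False) es @ map (Pair True) es) = UNIV \<times> E"
      using es(2) by (auto simp: UNIV_bool)
    then show ?thesis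
      using range_end_of es(2) assms(3) unfolding verts_G set_append set_map by (simp add: image_image[symmetric])
  qed
  moreover have "distinct ?ys"
    using es assms(2) end_of_eq_iff
    by (auto simp: distinct_map distinct_product inj_on_def)
  ultimately have "mset xs = mset ?ys"
    using xs set_eq_iff_mset_eq_distinct by blast
  then have "poly (char_poly (map_mat complex_of_real (signless_laplacian xs pocket_graph))) x = det_on ?ys ?f"
    using poly_char_poly_mat[OF xs(1), of "signless_entry pocket_graph" x] det_on_mset_eq
    by (simp only: map_mat_signless_laplacian[OF xs(1)])
  also have "\<dots> = a ^ length es * ((a - 2 * d) ^ (length es - 1) * (a - 2 * d - 2 * of_nat (length es))) *
      det_on ws (\<lambda>w w'. (if w = w' then x else 0) - signless_entry H w w') ^ length es"
  proof (rule det_on_pockets)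
    show "distinct es" by (rule es)
    show "es \<noteq> []" using len k by auto
    show "x - (2 * of_nat r + 2) \<noteq> 0" using assms(4) by simp
    show "d = of_nat (length ws) / (x - (2 * of_nat r + 2))"
      using H(3) by (simp add: d_def len of_nat_diff)
    show "(\<Sum>w'\<leftarrow>ws. (if w = w' then x else 0) - signless_entry H w w') = x - (2 * of_nat r + 2)"
      if "w \<in> set ws" for w
      using pocket_row_sum assms(2,3) that by blast
    fix e e' assume e: "e \<in> set es" "e' \<in> set es"
    then have e: "e \<in> E" "e' \<in> E" using es by auto
    show "?f (?i (b, e)) (?i (b', e')) = (if b = b' \<and> e = e' then a else 0) - 1" for b b'
      using end_of_eq_iff[OF e, of b b'] end_of_verts e degree_G_base[of "end_of (b, e)"] k H(3)
      by (auto simp: signless_entry_def edge_G a_def of_nat_diff)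
    show "?f (?i (b, e)) (Inr (e', w)) = (if e = e' then - 1 else 0)"
      "?f (Inr (e', w)) (?i (b, e)) = (if e' = e then - 1 else 0)" if "w \<in> set ws" for b w
      using that e end_of_mem_iff[OF e, of b] assms(3) by (auto simp: signless_entry_def edge_G)
    show "?f (Inr (e, w)) (Inr (e', w')) =
        (if e = e' then (if w = w' then x else 0) - signless_entry H w w' else 0)"
      if "w \<in> set ws" "w' \<in> set ws" for w w'
      using that e assms(3) by (auto simp: signless_entry_def edge_G degree_G_pocket degree_H)
  qed
  finally show ?thesis
    by (simp add: len poly_pocket_char_poly[OF assms(2)])
qed

text \<open>\<open>H\<close> is one pocket on the single edge \<open>uv\<close>, so the same
  determinant applies with one edge label, namely \<open>()\<close>. Now the ends have degree
  \<open>m - 1\<close>, whence \<open>a = x - (m - 2)\<close>.\<close>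

lemma poly_char_poly_H:
  assumes "vertex_order H ys" "distinct ws" "set ws = W" "x \<noteq> 2 * of_nat r + 2"
  defines "a \<equiv> x - (of_nat m - 2)" and "d \<equiv> (of_nat m - 2) / (x - (2 * of_nat r + 2))"
  shows "poly (char_poly (map_mat complex_of_real (signless_laplacian ys H))) x =
    a * (a - 2 * d - 2) * poly (pocket_char_poly ws) x"
proof -
  have len: "length ws = m - 2"
    using assms(2,3) card_W distinct_card by metis
  let ?i = "\<lambda>(b, e :: unit). if b then v else u"
  let ?zs = "map ?i (map (Pair False) [()] @ map (Pair True) [()]) @ map snd (List.product [()] ws)"
  let ?f = "\<lambda>p q. (if p = q then x else 0) - signless_entry H p q"
  have ys: "distinct ys" "set ys = verts H"
    using assms(1) by (auto simp: vertex_order_def)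
  have "set ?zs = verts H" "distinct ?zs"
    using assms(2,3) verts_H u_neq_v by (auto simp: o_def)
  then have "mset ys = mset ?zs"
    using ys set_eq_iff_mset_eq_distinct by blast
  then have "poly (char_poly (map_mat complex_of_real (signless_laplacian ys H))) x = det_on ?zs ?f"
    using poly_char_poly_mat[OF ys(1), of "signless_entry H" x] det_on_mset_eq
    by (simp only: map_mat_signless_laplacian[OF ys(1)])
  also have "\<dots> = a ^ length [()] *
      ((a - 2 * d) ^ (length [()] - 1) * (a - 2 * d - 2 * of_nat (length [()]))) *
      det_on ws (\<lambda>w w'. (if w = w' then x else 0) - signless_entry H w w') ^ length [()]"
  proof (rule det_on_pockets)
    show "x - (2 * of_nat r + 2) \<noteq> 0" using assms(4) by simp
    show "d = of_nat (length ws) / (x - (2 * of_nat r + 2))"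
      using H(3) by (simp add: d_def len of_nat_diff)
    show "(\<Sum>w'\<leftarrow>ws. (if w = w' then x else 0) - signless_entry H w w') = x - (2 * of_nat r + 2)"
      if "w \<in> set ws" for w
      using pocket_row_sum assms(2,3) that by blast
    fix e e' :: unit
    show "?f (?i (b, e)) (?i (b', e')) = (if b = b' \<and> e = e' then a else 0) - 1" for b b'
      using uv H(3) u_neq_v no_loops_H
      by (auto simp: signless_entry_def a_def of_nat_diff insert_commute)
    show "?f (?i (b, e)) (snd (e', w)) = (if e = e' then - 1 else 0)"
      "?f (snd (e', w)) (?i (b, e)) = (if e' = e then - 1 else 0)" if "w \<in> set ws" for b w
      using that assms(3) verts_H edge_u[of w] edge_v[of w]
      by (auto simp: signless_entry_def insert_commute)
  qed simp_all
  finally show ?thesis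
    by (simp add: poly_pocket_char_poly[OF assms(2)])
qed

end

section \<open>Comparison of the two factored characteristic polynomials\<close>

theorem theorem4p5:
  fixes F :: "'a graph" and H :: "'b graph" and E :: "'a set set"
    and u v :: 'b and s t :: "'a set \<Rightarrow> 'a" and k m r :: nat
    and xs :: "('a + 'a set \<times> 'b) list" and ys :: "'b list"
    and \<zeta> \<eta> :: complex
  defines "G \<equiv> edge_pocket_graph F E s t H u v"
  assumes "k \<ge> 1"
    and "complete_graph (2 * k) F"
    and "E \<subseteq> edges F" and "card E = k"
    and "perfect_matching F (edge_induced E)"
    and "simple_graph H" and "card (verts H) = m" and "m \<ge> 3"
    and "{u, v} \<in> edges H"
    and "degree_of H u = m - 1" and "degree_of H v = m - 1"
    and "regular_graph r (delete_verts H {u, v})" and "r \<ge> 2"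
    and "\<And>e. e \<in> E \<Longrightarrow> e = {s e, t e}"
    and "{#\<zeta>, \<eta>#} = quadratic_roots (2 * of_nat r + 2) (of_nat m) (2 * (of_nat m - 2))"
    and "vertex_order G xs" and "vertex_order H ys"
  shows "mat_spectrum (signless_laplacian xs G) =
      repeat_mset k (mat_spectrum (signless_laplacian ys H) - {#of_nat m - 2, \<zeta>, \<eta>#})
    + replicate_mset k (of_nat m + 2 * of_nat k - 4)
    + quadratic_roots (of_nat m + 4 * of_nat k - 4) (2 * of_nat r + 2) (2 * (of_nat m - 2))
    + repeat_mset (k - 1)
        (quadratic_roots (of_nat m + 2 * of_nat k - 4) (2 * of_nat r + 2) (2 * (of_nat m - 2)))"
proof -
  interpret edge_pockets F H E u v s t k m r
    by unfold_locales (use assms in auto)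
  have G_eq: "pocket_graph = G"
    by (simp add: pocket_graph_def G_def)
  have G: "vertex_order pocket_graph xs"
    using assms(17) by (simp add: G_eq)
  obtain ws where ws: "distinct ws" "set ws = W"
    using finite_distinct_list[OF finite_W] by blast
  \<comment> \<open>One copy of the root \<open>2 * r + 2\<close> is split off; the roots of
    \<open>h\<close> turn out to be the eigenvalues of \<open>Q(H)\<close> other than the three
    removed ones.\<close>
  obtain h where h: "pocket_char_poly ws = [:- (2 * of_nat r + 2), 1:] * h"
    using pocket_char_poly_root[OF ws] by (elim dvdE)
  define p :: complex where "p = of_nat m - 2"
  define \<rho> :: complex where "\<rho> = 2 * of_nat r + 2"
  have poly_linear: "poly [:- c, 1:] x = x - c" for c x :: complex
    by simp
  have poly_h: "poly (pocket_char_poly ws) x = (x - \<rho>) * poly h x" for x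
    by (simp add: h \<rho>_def algebra_simps)
  \<comment> \<open>\<open>quad a\<close> is the numerator of
    \<open>x - a - 2 * p / (x - \<rho>)\<close>. The values \<open>m\<close>,
    \<open>m + 2 * k - 4\<close> and \<open>m + 4 * k - 4\<close> of \<open>a\<close> give the three
    quadratics of the statement.\<close>
  define quad where "quad = (\<lambda>a. [:- a, 1:] * [:- \<rho>, 1:] - [:2 * p:])"
  let ?PG = "char_poly (map_mat complex_of_real (signless_laplacian xs G))"
  let ?PH = "char_poly (map_mat complex_of_real (signless_laplacian ys H))"
  let ?a = "of_nat m + 2 * of_nat k - 4 :: complex" and ?b = "of_nat m + 4 * of_nat k - 4 :: complex"
  \<comment> \<open>\<open>proots\<close> is additive on products only if these are nonzero;
    characteristic polynomials are monic.\<close>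
  have nonzero: "?PG \<noteq> 0" "?PH \<noteq> 0"
    using degree_monic_char_poly[of "map_mat complex_of_real (signless_laplacian xs G)" "length xs"]
      degree_monic_char_poly[of "map_mat complex_of_real (signless_laplacian ys H)" "length ys"]
    by (auto simp: signless_laplacian_def degree_matrix_def adjacency_matrix_def)
  have PG: "?PG = [:- ?a, 1:] ^ k * quad ?a ^ (k - 1) * quad ?b * h ^ k"
  proof (rule poly_eqI_off_point[of \<rho>])
    fix x :: complex assume x: "x \<noteq> \<rho>"
    \<comment> \<open>Of the \<open>k\<close> factors \<open>x - \<rho>\<close> supplied by the
      pockets, \<open>k - 1\<close> clear the repeated fraction and the last one clears the single
      fraction.\<close>
    have split: "(x - \<rho>) ^ k = (x - \<rho>) ^ (k - 1) * (x - \<rho>)"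
      using k by (simp flip: power_Suc2)
    define d where "d = p / (x - \<rho>)"
    have "poly ?PG x = (x - ?a) ^ k *
        ((x - ?a - 2 * d) ^ (k - 1) * (x - ?a - 2 * d - 2 * of_nat k)) * ((x - \<rho>) * poly h x) ^ k"
      using poly_char_poly_G[OF G ws, of x, unfolded G_eq] x
      by (simp add: poly_h d_def p_def \<rho>_def)
    also have "\<dots> = (x - ?a) ^ k * ((x - ?a - 2 * d) * (x - \<rho>)) ^ (k - 1) *
        ((x - ?a - 2 * d - 2 * of_nat k) * (x - \<rho>)) * poly h x ^ k"
      by (simp add: power_mult_distrib split mult_ac)
    also have "(x - ?a - 2 * d) * (x - \<rho>) = poly (quad ?a) x"
      using x by (simp add: d_def quad_def field_simps)
    also have "(x - ?a - 2 * d - 2 * of_nat k) * (x - \<rho>) = poly (quad ?b) x"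
      using x by (simp add: d_def quad_def field_simps)
    finally show "poly ?PG x = poly ([:- ?a, 1:] ^ k * quad ?a ^ (k - 1) * quad ?b * h ^ k) x"
      by (simp only: poly_mult poly_power poly_linear)
  qed
  have PH: "?PH = [:- p, 1:] * quad (of_nat m) * h"
  proof (rule poly_eqI_off_point[of \<rho>])
    fix x :: complex assume x: "x \<noteq> \<rho>"
    define d where "d = p / (x - \<rho>)"
    have "poly ?PH x = (x - p) * (x - p - 2 * d - 2) * ((x - \<rho>) * poly h x)"
      using poly_char_poly_H[OF assms(18) ws, of x] x
      by (simp add: poly_h d_def p_def \<rho>_def)
    also have "\<dots> = (x - p) * ((x - p - 2 * d - 2) * (x - \<rho>)) * poly h x"
      by simp
    also have "(x - p - 2 * d - 2) * (x - \<rho>) = poly (quad (of_nat m)) x"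
      using x by (simp add: d_def quad_def p_def field_simps)
    finally show "poly ?PH x = poly ([:- p, 1:] * quad (of_nat m) * h) x"
      by (simp only: poly_mult poly_linear)
  qed
  have quadratic_roots: "proots (quad a) = quadratic_roots a \<rho> (2 * p)" for a
    by (simp add: quad_def quadratic_roots_def)
  \<comment> \<open>The defining quadratic of \<open>\<zeta>\<close> and \<open>\<eta>\<close> has
    its two linear factors in the opposite order.\<close>
  have \<zeta>\<eta>: "{#\<zeta>, \<eta>#} = proots (quad (of_nat m))"
    using assms(16) by (simp only: quad_def quadratic_roots_def p_def \<rho>_def mult.commute)
  have "mat_spectrum (signless_laplacian ys H) = {#p#} + {#\<zeta>, \<eta>#} + proots h"
    using nonzero(2) unfolding mat_spectrum_def PH \<zeta>\<eta> by (simp add: proots_mult del: mult_pCons_left)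
  \<comment> \<open>The three removed values are summands of the spectrum, so the multiset
    difference undoes the sum without truncation.\<close>
  then have "mat_spectrum (signless_laplacian ys H) - {#of_nat m - 2, \<zeta>, \<eta>#} = proots h"
    by (simp add: p_def)
  moreover have "mat_spectrum (signless_laplacian xs G) = replicate_mset k ?a +
      repeat_mset (k - 1) (proots (quad ?a)) + proots (quad ?b) + repeat_mset k (proots h)"
    using nonzero(1) unfolding mat_spectrum_def PG
    by (simp add: proots_mult proots_power del: mult_pCons_left)
  ultimately show ?thesis
    by (simp add: quadratic_roots p_def \<rho>_def)
qed

end
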